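(* Consider the DRV process with choice function $k(n)$ satisfying $k(n)\to\infty$ and $k(n)=\Omega(\log n)$. Then for every fixed $d\in(0,1)$, with high probability no giant component exists at time $t=\lfloor dn\rfloor$; that is, $C_1(\lfloor dn\rfloor)/n\to 0$ in probability as $n\to\infty$, where $C_1(t)$ is the number of vertices in the largest connected component of the graph after $t$ edges have been added.
   Context: The DRV process (Degree Rule with Varying Choice): fix a function $k=k(n)$ with $2\le k(n)\le n$. Start at time $t=0$ with $n$ isolated vertices and no edges. At each time step $t=0,1,2,\dots$ (one edge is added per step, so after $t$ steps the graph has $t$ edges; multiple edges are allowed), independently of the past choose a set $V_t$ of $k(n)$ distinct vertices uniformly at random, and let $V_{t,d}$ be the set of vertices in $V_t$ whose current degree is $d$. If $|V_{t,0}|\ge 2$, add an edge between two vertices of $V_{t,0}$ sampled uniformly at random without replacement; otherwise, if $|V_{t,1}|\ge 2$, add an edge between two vertices of $V_{t,1}$ sampled uniformly at random without replacement; otherwise add an edge between two vertices of $V_t$ sampled uniformly at random without replacement. The process may be run for any number of steps (including beyond $t=n$). "With high probability" (w.h.p.) means with probability tending to $1$ as $n\to\infty$. *)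

theory Defs
  imports "HOL-Probability.Probability" "HOL-Library.Landau_Symbols"
begin

text \<open>A multigraph on vertex set {0..<n} is a list of edges; each edge is a
2-element set of vertices. The list is in order of insertion (newest first);
multiple edges are allowed.\<close>

type_synonym mgraph = "nat set list"

definition deg :: "mgraph \<Rightarrow> nat \<Rightarrow> nat" where
  "deg G v = length (filter (\<lambda>e. v \<in> e) G)"

definition drv_candidates :: "mgraph \<Rightarrow> nat set \<Rightarrow> nat set" where
  "drv_candidates G V =
     (let V0 = {v\<in>V. deg G v = 0}; V1 = {v\<in>V. deg G v = 1} in
      if card V0 \<ge> 2 then V0 else if card V1 \<ge> 2 then V1 else V)"

definition drv_step :: "nat \<Rightarrow> nat \<Rightarrow> mgraph \<Rightarrow> mgraph pmf" where
  "drv_step n k G =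
     do { V \<leftarrow> pmf_of_set {S. S \<subseteq> {..<n} \<and> card S = k};
          e \<leftarrow> pmf_of_set {e. e \<subseteq> drv_candidates G V \<and> card e = 2};
          return_pmf (e # G) }"

fun drv :: "nat \<Rightarrow> nat \<Rightarrow> nat \<Rightarrow> mgraph pmf" where
  "drv n k 0 = return_pmf []"
| "drv n k (Suc t) = bind_pmf (drv n k t) (drv_step n k)"

definition connected_in :: "mgraph \<Rightarrow> nat \<Rightarrow> nat \<Rightarrow> bool" where
  "connected_in G u v \<longleftrightarrow> (u, v) \<in> {(a, b). {a, b} \<in> set G}\<^sup>*"

definition component :: "nat \<Rightarrow> mgraph \<Rightarrow> nat \<Rightarrow> nat set" where
  "component n G v = {u\<in>{..<n}. connected_in G u v}"

definition largest_component :: "nat \<Rightarrow> mgraph \<Rightarrow> nat" where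
  "largest_component n G = Max (insert 0 ((\<lambda>v. card (component n G v)) ` {..<n}))"

end

theory Submission
  imports Defs "HOL-Real_Asymp.Real_Asymp"
begin

text \<open>
  Put \<open>\<gamma> = (1 - d) / 2\<close>. Call a new edge good if it joins two isolated vertices, or joins two
  vertices of degree 1 while at least \<open>\<gamma> n\<close> such vertices exist. Up to time \<open>dn\<close> the degree sum
  forces at least \<open>\<gamma> n\<close> vertices of degree 0 or at least \<open>\<gamma> n\<close> of degree 1, so an edge is bad
  with probability at most \<open>2 exp (-\<gamma> k / 3)\<close>, which is \<open>O(n powr -a)\<close> for some \<open>a > 0\<close>.

  The components spanned by the good edges (the blocks) contain at most two vertices of degree
  at most 1, and by symmetry a good edge between vertices of degree 1 is uniformly distributed.
  Let \<open>S\<close> be the sum of \<open>(1 + \<delta>) ^ |A| - 1\<close> over all blocks \<open>A\<close>. Merging \<open>A\<close> and \<open>B\<close> increases \<open>S\<close> by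
  the product of their two weights, so the expected increment is \<open>O(S\<^sup>2 / n\<^sup>2)\<close> and \<open>-1/S\<close> drifts by
  only \<open>O(1 / n\<^sup>2)\<close> per step. Initially \<open>1/S = 1 / (\<delta> n)\<close>; hence \<open>S < n\<close> holds up to time \<open>dn\<close> with
  probability \<open>1 - O(\<delta>)\<close>, and then every block has at most \<open>2 ln (1 + n) / \<delta>\<close> vertices. A component of
  the whole graph is covered by one block and the blocks of the endpoints of the bad edges.
  Choosing \<open>\<delta> = 1 / ln n\<close> makes the total \<open>o(n)\<close>.
\<close>

section \<open>The distribution of the next edge and its support\<close>

definition ksubsets :: "nat \<Rightarrow> nat \<Rightarrow> nat set set" where
  "ksubsets n k = {S. S \<subseteq> {..<n} \<and> card S = k}"

text \<open>The law of the new edge is separated from the list it is added to, so that a vertex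
  permutation can act on the edge while \<open>G\<close> stays fixed.\<close>

definition drv_edge :: "nat \<Rightarrow> nat \<Rightarrow> mgraph \<Rightarrow> nat set pmf" where
  "drv_edge n k G =
     bind_pmf (pmf_of_set (ksubsets n k))
       (\<lambda>V. pmf_of_set {e. e \<subseteq> drv_candidates G V \<and> card e = 2})"

definition deg_class :: "nat \<Rightarrow> mgraph \<Rightarrow> nat \<Rightarrow> nat set" where
  "deg_class n G i = {v\<in>{..<n}. deg G v = i}"

lemma drv_step_eq: "drv_step n k G = map_pmf (\<lambda>e. e # G) (drv_edge n k G)"
  by (simp add: drv_step_def drv_edge_def ksubsets_def map_bind_pmf map_pmf_def bind_assoc_pmf bind_return_pmf)

lemma finite_deg_class [simp]: "finite (deg_class n G i)"
  by (simp add: deg_class_def)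

lemma finite_ksubsets [simp]: "finite (ksubsets n k)"
  unfolding ksubsets_def by (rule finite_subset[of _ "Pow {..<n}"]) auto

lemma card_ksubsets: "card (ksubsets n k) = n choose k"
  unfolding ksubsets_def using n_subsets[of "{..<n}" k] by simp

lemma ksubsets_nonempty: "k \<le> n \<Longrightarrow> ksubsets n k \<noteq> {}"
  by (metis card.empty card_ksubsets less_irrefl zero_less_binomial)

lemma finite_pairs: "finite A \<Longrightarrow> finite {e. e \<subseteq> A \<and> card e = 2}"
  by (rule finite_subset[of _ "Pow A"]) auto

lemma pairs_nonempty: "finite A \<Longrightarrow> 2 \<le> card A \<Longrightarrow> {e. e \<subseteq> A \<and> card e = 2} \<noteq> {}"
proof -
  assume "finite A" "2 \<le> card A"
  then have "0 < card {e. e \<subseteq> A \<and> card e = 2}" by (simp add: n_subsets)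
  then show ?thesis by (metis card.empty less_irrefl)
qed

lemma drv_candidates_subset: "drv_candidates G V \<subseteq> V"
  by (auto simp: drv_candidates_def Let_def)

lemma card_drv_candidates: "2 \<le> card V \<Longrightarrow> 2 \<le> card (drv_candidates G V)"
  by (auto simp: drv_candidates_def Let_def)

lemma ksubset_pairs:
  assumes "2 \<le> k" "V \<in> ksubsets n k"
  shows "finite {e. e \<subseteq> drv_candidates G V \<and> card e = 2}"
    and "{e. e \<subseteq> drv_candidates G V \<and> card e = 2} \<noteq> {}"
proof -
  have V: "finite V" "card V = k"
    using assms by (auto simp: ksubsets_def intro: finite_subset)
  have fin: "finite (drv_candidates G V)"
    using V(1) drv_candidates_subset finite_subset by blast
  then show "finite {e. e \<subseteq> drv_candidates G V \<and> card e = 2}"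
    by (rule finite_pairs)
  have "2 \<le> card (drv_candidates G V)"
    using V assms(1) card_drv_candidates by blast
  with fin show "{e. e \<subseteq> drv_candidates G V \<and> card e = 2} \<noteq> {}"
    by (rule pairs_nonempty)
qed

lemma set_drv_edge:
  assumes "2 \<le> k" "k \<le> n" "e \<in> set_pmf (drv_edge n k G)"
  obtains V where "V \<in> ksubsets n k" "e \<subseteq> drv_candidates G V" "card e = 2"
proof -
  from assms(3) obtain V where V: "V \<in> ksubsets n k"
    and e: "e \<in> set_pmf (pmf_of_set {e. e \<subseteq> drv_candidates G V \<and> card e = 2})"
    unfolding drv_edge_def using ksubsets_nonempty[OF assms(2)] by auto
  then show ?thesis
    using that set_pmf_of_set[OF ksubset_pairs(2,1)[OF assms(1) V]] by auto
qed

lemma set_drv_edge_subset: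
  assumes "2 \<le> k" "k \<le> n" "e \<in> set_pmf (drv_edge n k G)"
  shows "e \<subseteq> {..<n}" "card e = 2"
proof -
  from set_drv_edge[OF assms] obtain V
    where "V \<in> ksubsets n k" "e \<subseteq> drv_candidates G V" "card e = 2" by blast
  then show "e \<subseteq> {..<n}" "card e = 2"
    using drv_candidates_subset[of G V] by (auto simp: ksubsets_def)
qed

subsection \<open>Symmetry\<close>

lemma drv_candidates_image:
  assumes p: "inj p" "\<And>v. deg G (p v) = deg G v"
  shows "drv_candidates G (p ` V) = p ` drv_candidates G V"
proof -
  have *: "{v \<in> p ` V. deg G v = i} = p ` {v \<in> V. deg G v = i}" for i
    using p(2) by auto
  have **: "card (p ` A) = card A" for A
    using p(1) by (auto intro: card_image inj_on_subset)
  show ?thesis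
    unfolding drv_candidates_def Let_def * ** by auto
qed

lemma image_pairs:
  assumes "bij p"
  shows "(`) p ` {e. e \<subseteq> A \<and> card e = 2} = {e. e \<subseteq> p ` A \<and> card e = 2}"
proof (intro equalityI subsetI)
  fix e assume "e \<in> {e. e \<subseteq> p ` A \<and> card e = 2}"
  then have e: "e \<subseteq> p ` A" "card e = 2" by auto
  have "e = p ` (inv p ` e)" using assms by (simp add: image_f_inv_f bij_is_surj)
  moreover have "inv p ` e \<subseteq> A"
    using e(1) assms by (auto simp: bij_is_inj)
  moreover have "card (inv p ` e) = 2"
    using e(2) assms bij_imp_bij_inv by (metis bij_is_inj card_image inj_on_subset subset_UNIV)
  ultimately show "e \<in> (`) p ` {e. e \<subseteq> A \<and> card e = 2}" by blast
next
  fix e assume "e \<in> (`) p ` {e. e \<subseteq> A \<and> card e = 2}"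
  then obtain e' where "e = p ` e'" "e' \<subseteq> A" "card e' = 2" by auto
  moreover have "card (p ` e') = card e'"
    using assms by (meson bij_is_inj card_image inj_on_subset subset_UNIV)
  ultimately show "e \<in> {e. e \<subseteq> p ` A \<and> card e = 2}" by auto
qed

text \<open>The rule sees only degrees, so a vertex permutation that preserves degrees preserves the
  law of the edge, even if it is no automorphism of \<open>G\<close>: it permutes the samples and
  carries candidates to candidates.\<close>

lemma map_drv_edge:
  assumes k: "2 \<le> k" "k \<le> n"
    and p: "bij p" "\<And>v. deg G (p v) = deg G v" "p ` {..<n} = {..<n}"
  shows "map_pmf ((`) p) (drv_edge n k G) = drv_edge n k G"
proof -
  have inj: "inj ((`) p)"
    using inj_image_eq_iff[OF bij_is_inj[OF p(1)]] by (auto simp: inj_on_def)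
  have img: "(`) p ` ksubsets n k = ksubsets n k"
  proof (rule card_subset_eq)
    show "(`) p ` ksubsets n k \<subseteq> ksubsets n k"
      using p by (auto simp: ksubsets_def card_image inj_on_subset[OF bij_is_inj])
    show "card ((`) p ` ksubsets n k) = card (ksubsets n k)"
      using inj by (auto intro: card_image inj_on_subset)
  qed simp
  define F where "F V = pmf_of_set {e. e \<subseteq> drv_candidates G V \<and> card e = 2}" for V
  have F: "map_pmf ((`) p) (F V) = F (p ` V)" if "V \<in> ksubsets n k" for V
  proof -
    have "map_pmf ((`) p) (F V) = pmf_of_set ((`) p ` {e. e \<subseteq> drv_candidates G V \<and> card e = 2})"
      unfolding F_def using inj ksubset_pairs[OF k(1) that]
      by (intro map_pmf_of_set_inj) (auto intro: inj_on_subset)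
    then show ?thesis
      using p by (simp add: F_def image_pairs drv_candidates_image bij_is_inj)
  qed
  have "map_pmf ((`) p) (drv_edge n k G) = bind_pmf (pmf_of_set (ksubsets n k)) (\<lambda>V. F (p ` V))"
    unfolding drv_edge_def F_def[symmetric] map_bind_pmf
    by (rule bind_pmf_cong) (use F ksubsets_nonempty k in auto)
  also have "\<dots> = bind_pmf (map_pmf ((`) p) (pmf_of_set (ksubsets n k))) F"
    by (simp add: bind_map_pmf)
  also have "map_pmf ((`) p) (pmf_of_set (ksubsets n k)) = pmf_of_set (ksubsets n k)"
    using map_pmf_of_set_inj[of "(`) p" "ksubsets n k"] inj img ksubsets_nonempty[OF k(2)]
    by (auto intro: inj_on_subset)
  finally show ?thesis
    by (simp add: drv_edge_def F_def)
qed

lemma pmf_drv_edge_transpose: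
  assumes k: "2 \<le> k" "k \<le> n" and ab: "a \<in> deg_class n G i" "b \<in> deg_class n G i"
  shows "pmf (drv_edge n k G) (Transposition.transpose a b ` e) = pmf (drv_edge n k G) e"
proof -
  let ?p = "Transposition.transpose a b"
  have "map_pmf ((`) ?p) (drv_edge n k G) = drv_edge n k G"
  proof (rule map_drv_edge[OF k])
    show "deg G (?p v) = deg G v" for v
      using ab by (auto simp: deg_class_def Transposition.transpose_def)
    show "?p ` {..<n} = {..<n}"
      using ab by (intro transpose_image_eq) (auto simp: deg_class_def)
  qed simp
  moreover have "inj ((`) ?p)"
    using inj_image_eq_iff[OF inj_on_transpose[of a b UNIV]] by (auto intro: injI)
  ultimately show ?thesis
    using pmf_map_inj' by metis
qed

text \<open>Two transpositions inside the degree class carry \<open>e\<close> to \<open>f\<close>: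
  the first moves \<open>a\<close> to \<open>c\<close>, the second moves the image of
  \<open>b\<close> to \<open>d\<close> and leaves \<open>c\<close> in place.\<close>

lemma pmf_drv_edge_eq:
  assumes k: "2 \<le> k" "k \<le> n"
    and e: "e \<subseteq> deg_class n G i" "card e = 2"
    and f: "f \<subseteq> deg_class n G i" "card f = 2"
  shows "pmf (drv_edge n k G) e = pmf (drv_edge n k G) f"
proof -
  obtain a b where ab: "e = {a, b}" "a \<noteq> b" using e(2) by (auto simp: card_2_iff)
  obtain c d where cd: "f = {c, d}" "c \<noteq> d" using f(2) by (auto simp: card_2_iff)
  \<comment> \<open>This is \<open>b\<close> itself unless \<open>b = c\<close>, in which case it is
    \<open>a\<close>.\<close>
  define b' where "b' = Transposition.transpose a c b"
  have 1: "Transposition.transpose a c ` e = {c, b'}" "b' \<noteq> c" "b' \<in> deg_class n G i"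
    using ab cd e f by (auto simp: b'_def Transposition.transpose_def)
  have 2: "Transposition.transpose b' d ` {c, b'} = f"
    using 1 cd by (auto simp: Transposition.transpose_def)
  have "pmf (drv_edge n k G) e = pmf (drv_edge n k G) (Transposition.transpose a c ` e)"
    by (intro pmf_drv_edge_transpose[OF k, symmetric]) (use e f ab cd in auto)
  also have "\<dots> = pmf (drv_edge n k G) (Transposition.transpose b' d ` Transposition.transpose a c ` e)"
    by (intro pmf_drv_edge_transpose[OF k, symmetric]) (use 1 f cd in auto)
  finally show ?thesis using 1 2 by simp
qed

text \<open>The pairs inside one degree class are equally likely, and their probabilities sum to at
  most 1.\<close>

lemma pmf_drv_edge_le:
  assumes k: "2 \<le> k" "k \<le> n" and e: "e \<subseteq> deg_class n G i" "card e = 2"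
  shows "pmf (drv_edge n k G) e * (card (deg_class n G i) choose 2) \<le> 1"
proof -
  let ?E = "{e. e \<subseteq> deg_class n G i \<and> card e = 2}"
  have "pmf (drv_edge n k G) e * (card (deg_class n G i) choose 2) = (\<Sum>f\<in>?E. pmf (drv_edge n k G) e)"
    by (simp add: n_subsets)
  also have "\<dots> = (\<Sum>f\<in>?E. pmf (drv_edge n k G) f)"
    by (intro sum.cong refl pmf_drv_edge_eq[OF k]) (use e in auto)
  also have "\<dots> = measure_pmf.prob (drv_edge n k G) ?E"
    by (simp add: measure_measure_pmf_finite finite_pairs)
  also have "\<dots> \<le> 1" by simp
  finally show ?thesis .
qed

subsection \<open>Samples missing a linear set\<close>

text \<open>The ratio of the binomials is a product of factors \<open>(a - i) / (n - i)\<close>,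
  each at most \<open>a / n\<close>. Multiplying out keeps the statement in the natural numbers; the
  induction scales by \<open>Suc k\<close> to apply absorption.\<close>

lemma binomial_ratio_le: "a \<le> n \<Longrightarrow> (a choose k) * n ^ k \<le> (n choose k) * a ^ k"
proof (induction k)
  case (Suc k)
  show ?case
  proof (cases "k < a")
    case True
    have absorb: "Suc k * (m choose Suc k) = (m - k) * (m choose k)" for m
      by (simp only: binomial_absorb_comp binomial_absorption)
    have "(a - k) * n \<le> (n - k) * a"
      using diff_le_mono2[OF mult_right_mono[OF Suc.prems, of k], of "a * n"]
      by (simp add: algebra_simps)
    have shift: "Suc k * ((b choose Suc k) * m ^ Suc k) = ((b - k) * m) * ((b choose k) * m ^ k)" for b m
    proof -
      have "Suc k * ((b choose Suc k) * m ^ Suc k) = Suc k * (b choose Suc k) * (m * m ^ k)"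
        by (simp only: power_Suc mult.assoc)
      then show ?thesis by (simp only: absorb ac_simps)
    qed
    have "Suc k * ((a choose Suc k) * n ^ Suc k) = ((a - k) * n) * ((a choose k) * n ^ k)"
      by (rule shift)
    also have "\<dots> \<le> ((n - k) * a) * ((n choose k) * a ^ k)"
      by (rule mult_le_mono[OF \<open>(a - k) * n \<le> (n - k) * a\<close> Suc.IH[OF Suc.prems]])
    also have "\<dots> = Suc k * ((n choose Suc k) * a ^ Suc k)"
      by (rule shift[symmetric])
    finally show ?thesis by (simp only: Suc_mult_le_cancel1)
  qed (simp add: binomial_eq_0)
qed simp

text \<open>Sampling without replacement misses \<open>D\<close> at most as often as sampling with
  replacement.\<close>

lemma prob_miss_le:
  assumes k: "k \<le> n" and n: "0 < n" and D: "D \<subseteq> {..<n}"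
  shows "measure_pmf.prob (pmf_of_set (ksubsets n k)) {V. V \<inter> D = {}} \<le> (1 - card D / n) ^ k"
proof -
  have fin: "finite D" and le: "card D \<le> n"
    using D finite_subset card_mono[OF _ D] by auto
  have "ksubsets n k \<inter> {V. V \<inter> D = {}} = {V. V \<subseteq> {..<n} - D \<and> card V = k}"
    by (auto simp: ksubsets_def)
  then have "card (ksubsets n k \<inter> {V. V \<inter> D = {}}) = (n - card D) choose k"
    using D fin by (simp add: n_subsets card_Diff_subset)
  then have "measure_pmf.prob (pmf_of_set (ksubsets n k)) {V. V \<inter> D = {}} =
      real ((n - card D) choose k) / real (n choose k)"
    using measure_pmf_of_set[OF ksubsets_nonempty[OF k] finite_ksubsets] by (simp add: card_ksubsets)
  also have "\<dots> \<le> real (n - card D) ^ k / real n ^ k"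
  proof -
    have "real (((n - card D) choose k) * n ^ k) \<le> real ((n choose k) * (n - card D) ^ k)"
      using binomial_ratio_le[of "n - card D" n k] by (intro of_nat_mono) simp
    then show ?thesis
      using n k by (simp add: divide_simps mult.commute)
  qed
  also have "\<dots> = (1 - card D / n) ^ k"
    using le n by (simp add: power_divide[symmetric] of_nat_diff diff_divide_distrib)
  finally show ?thesis .
qed

text \<open>If at most one vertex of \<open>D\<close> is sampled, then one half of \<open>D\<close> is missed altogether.\<close>

lemma prob_le_one_hit:
  assumes k: "k \<le> n" and n: "0 < n" and D: "D \<subseteq> {..<n}"
  shows "measure_pmf.prob (pmf_of_set (ksubsets n k)) {V. card (V \<inter> D) \<le> 1}
           \<le> 2 * (1 - (card D div 2) / n) ^ k"
proof -
  let ?M = "pmf_of_set (ksubsets n k)"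
  have fin: "finite D" using D finite_subset by auto
  obtain A where A: "A \<subseteq> D" "card A = card D div 2"
    using obtain_subset_with_card_n[of "card D div 2" D] div_le_dividend by metis
  have "card D div 2 \<le> card (D - A)"
    using A fin by (simp add: card_Diff_subset finite_subset)
  then obtain B where B: "B \<subseteq> D - A" "card B = card D div 2"
    using obtain_subset_with_card_n[of "card D div 2" "D - A"] by metis
  have "{V. card (V \<inter> D) \<le> 1} \<subseteq> {V. V \<inter> A = {}} \<union> {V. V \<inter> B = {}}"
  proof
    fix V assume V: "V \<in> {V. card (V \<inter> D) \<le> 1}"
    show "V \<in> {V. V \<inter> A = {}} \<union> {V. V \<inter> B = {}}"
    proof (rule ccontr)
      assume "\<not> ?thesis"
      then obtain a b where ab: "a \<in> V" "a \<in> A" "b \<in> V" "b \<in> B" by blast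
      have "{a, b} \<subseteq> V \<inter> D" "a \<noteq> b" using A(1) B(1) ab by blast+
      then have "2 \<le> card (V \<inter> D)"
        using card_mono[of "V \<inter> D" "{a, b}"] fin by simp
      with V show False by simp
    qed
  qed
  then have "measure_pmf.prob ?M {V. card (V \<inter> D) \<le> 1}
      \<le> measure_pmf.prob ?M ({V. V \<inter> A = {}} \<union> {V. V \<inter> B = {}})"
    by (intro measure_pmf.finite_measure_mono) auto
  also have "\<dots> \<le> measure_pmf.prob ?M {V. V \<inter> A = {}} + measure_pmf.prob ?M {V. V \<inter> B = {}}"
    by (intro measure_Un_le) auto
  also have "\<dots> \<le> 2 * (1 - (card D div 2) / n) ^ k"
  proof -
    have "A \<subseteq> {..<n}" "B \<subseteq> {..<n}" using A B D by auto
    from add_mono[OF prob_miss_le[OF k n this(1)] prob_miss_le[OF k n this(2)]] show ?thesis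
      by (simp only: A(2) B(2) mult_2)
  qed
  finally show ?thesis .
qed

subsection \<open>Merging along good edges\<close>

text \<open>An isolated pair joins two blocks of weight \<open>\<delta>\<close> each, so its effect
  is bounded outright. A pair of degree 1 is controlled through its probability, which is small when
  the class has linear size; hence the threshold in that case alone.\<close>

definition good_edge :: "nat \<Rightarrow> real \<Rightarrow> mgraph \<Rightarrow> nat set \<Rightarrow> bool" where
  "good_edge n \<gamma> G e \<longleftrightarrow>
     e \<subseteq> deg_class n G 0 \<or> e \<subseteq> deg_class n G 1 \<and> \<gamma> * n \<le> card (deg_class n G 1)"

text \<open>Written with all blocks met by \<open>e\<close>, this needs no choice of endpoints; if
  \<open>e\<close> meets only one block, the partition is unchanged.\<close>

definition merge_blocks :: "'a set set \<Rightarrow> 'a set \<Rightarrow> 'a set set" where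
  "merge_blocks P e = insert (\<Union>{A\<in>P. A \<inter> e \<noteq> {}}) (P - {A\<in>P. A \<inter> e \<noteq> {}})"

text \<open>The list has the newest edge first, so each edge is judged in the graph \<open>G\<close>
  that preceded it, and the blocks are a function of the graph without extra state in the
  process.\<close>

primrec blocks :: "nat \<Rightarrow> real \<Rightarrow> mgraph \<Rightarrow> nat set set" where
  "blocks n \<gamma> [] = (\<lambda>v. {v}) ` {..<n}"
| "blocks n \<gamma> (e # G) =
     (if good_edge n \<gamma> G e then merge_blocks (blocks n \<gamma> G) e else blocks n \<gamma> G)"

primrec bad_edges :: "nat \<Rightarrow> real \<Rightarrow> mgraph \<Rightarrow> nat set list" where
  "bad_edges n \<gamma> [] = []"
| "bad_edges n \<gamma> (e # G) =
     (if good_edge n \<gamma> G e then bad_edges n \<gamma> G else e # bad_edges n \<gamma> G)"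

definition valid_graph :: "nat \<Rightarrow> mgraph \<Rightarrow> bool" where
  "valid_graph n G \<longleftrightarrow> (\<forall>e\<in>set G. e \<subseteq> {..<n} \<and> card e = 2)"

lemma valid_graph_simps [simp]:
  "valid_graph n []"
  "valid_graph n (e # G) \<longleftrightarrow> e \<subseteq> {..<n} \<and> card e = 2 \<and> valid_graph n G"
  by (auto simp: valid_graph_def)

lemma deg_simps [simp]: "deg [] v = 0" "deg (e # G) v = deg G v + of_bool (v \<in> e)"
  by (auto simp: deg_def)

lemma partition_on_unique:
  assumes "partition_on S P" "v \<in> S"
  obtains A where "A \<in> P" "v \<in> A" "{X\<in>P. v \<in> X} = {A}"
proof -
  from assms obtain A where A: "A \<in> P" "v \<in> A"
    using partition_onD1 by blast
  moreover have "X = A" if "X \<in> P" "v \<in> X" for X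
    using that A partition_onD2[OF assms(1)] by (auto simp: disjoint_def)
  ultimately show ?thesis using that by blast
qed

lemma merge_edge:
  assumes P: "partition_on S P" and uv: "u \<in> S" "v \<in> S"
  obtains A B where "A \<in> P" "u \<in> A" "{X\<in>P. u \<in> X} = {A}"
    and "B \<in> P" "v \<in> B" "{X\<in>P. v \<in> X} = {B}"
    and "merge_blocks P {u, v} = insert (A \<union> B) (P - {A, B})"
proof -
  obtain A where A: "A \<in> P" "u \<in> A" "{X\<in>P. u \<in> X} = {A}"
    using partition_on_unique[OF P uv(1)] .
  obtain B where B: "B \<in> P" "v \<in> B" "{X\<in>P. v \<in> X} = {B}"
    using partition_on_unique[OF P uv(2)] .
  have "{X\<in>P. X \<inter> {u, v} \<noteq> {}} = {X\<in>P. u \<in> X} \<union> {X\<in>P. v \<in> X}" by auto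
  also have "\<dots> = {A, B}" unfolding A(3) B(3) by auto
  finally have "merge_blocks P {u, v} = insert (A \<union> B) (P - {A, B})"
    unfolding merge_blocks_def by simp
  then show ?thesis using that A B by blast
qed

lemma partition_on_merge:
  assumes P: "partition_on S P" and uv: "u \<in> S" "v \<in> S"
  shows "partition_on S (merge_blocks P {u, v})"
proof -
  obtain A B where A: "A \<in> P" "u \<in> A" and B: "B \<in> P" "v \<in> B"
    and m: "merge_blocks P {u, v} = insert (A \<union> B) (P - {A, B})"
    using merge_edge[OF P uv] by metis
  have dj: "X \<inter> Y = {}" if "X \<in> P" "Y \<in> P" "X \<noteq> Y" for X Y
    using partition_onD2[OF P] that by (auto simp: disjoint_def)
  show ?thesis unfolding m
  proof (rule partition_onI)
    show "\<Union>(insert (A \<union> B) (P - {A, B})) = S"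
      using partition_onD1[OF P] A B by auto
    show "disjnt X Y" if "X \<in> insert (A \<union> B) (P - {A, B})" "Y \<in> insert (A \<union> B) (P - {A, B})"
      "X \<noteq> Y" for X Y
      using that A(1) B(1) dj unfolding disjnt_def by blast
    show "{} \<notin> insert (A \<union> B) (P - {A, B})"
      using A partition_onD3[OF P] by auto
  qed
qed

text \<open>The second clause gives isolated vertices blocks of weight exactly
  \<open>\<delta>\<close>. The third bounds how often a block is counted in a sum over the vertices
  of degree 1.\<close>

definition blocks_inv :: "nat \<Rightarrow> mgraph \<Rightarrow> nat set set \<Rightarrow> bool" where
  "blocks_inv n G P \<longleftrightarrow> partition_on {..<n} P \<and> (\<forall>v<n. deg G v = 0 \<longrightarrow> {v} \<in> P) \<and>
     (\<forall>A\<in>P. card {v\<in>A. deg G v \<le> 1} \<le> 2)"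

text \<open>Joining two isolated vertices creates a block of just these two. Joining two vertices of
  degree 1 lifts both to degree 2, so each of the old blocks keeps at most one vertex of low
  degree.\<close>

lemma blocks_inv_merge:
  assumes inv: "blocks_inv n G P" and e: "e \<subseteq> {..<n}" "card e = 2"
    and deg: "(\<forall>v\<in>e. deg G v = 0) \<or> (\<forall>v\<in>e. deg G v = 1)"
  shows "blocks_inv n (e # G) (merge_blocks P e)"
proof -
  obtain u v where uv: "e = {u, v}" "u \<noteq> v" using e(2) by (auto simp: card_2_iff)
  have P: "partition_on {..<n} P" and iso: "\<And>v. v < n \<Longrightarrow> deg G v = 0 \<Longrightarrow> {v} \<in> P"
    and two: "\<And>A. A \<in> P \<Longrightarrow> card {v\<in>A. deg G v \<le> 1} \<le> 2"
    using inv by (auto simp: blocks_inv_def)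
  have S: "u \<in> {..<n}" "v \<in> {..<n}" using e uv by auto
  obtain A B where A: "A \<in> P" "u \<in> A" "{X\<in>P. u \<in> X} = {A}"
    and B: "B \<in> P" "v \<in> B" "{X\<in>P. v \<in> X} = {B}"
    and m: "merge_blocks P {u, v} = insert (A \<union> B) (P - {A, B})"
    using merge_edge[OF P S] .
  have fin: "finite X" if "X \<in> P" for X
  proof (rule finite_subset)
    show "X \<subseteq> {..<n}" using that partition_onD1[OF P] by blast
  qed simp
  have "{w} \<in> merge_blocks P e" if "w < n" "deg (e # G) w = 0" for w
  proof -
    have "w \<notin> e" "{w} \<in> P" using that iso[of w] by (auto split: if_splits)
    then show ?thesis by (auto simp: merge_blocks_def)
  qed
  moreover have "card {w\<in>X. deg (e # G) w \<le> 1} \<le> 2" if X: "X \<in> merge_blocks P e" for X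
  proof (cases "X = A \<union> B")
    case False
    then have "X \<in> P" using X m uv by auto
    then have "card {w\<in>X. deg (e # G) w \<le> 1} \<le> card {w\<in>X. deg G w \<le> 1}"
      using fin by (intro card_mono) auto
    with two[OF \<open>X \<in> P\<close>] show ?thesis by linarith
  next
    case True
    show ?thesis
    proof (cases "\<forall>v\<in>e. deg G v = 0")
      case True
      then have "{u} \<in> {X\<in>P. u \<in> X}" "{v} \<in> {X\<in>P. v \<in> X}" using iso S uv by auto
      then have "A = {u}" "B = {v}" unfolding A(3) B(3) by simp_all
      then have "{w\<in>X. deg (e # G) w \<le> 1} \<subseteq> {u, v}" using \<open>X = A \<union> B\<close> by auto
      from card_mono[OF _ this] uv(2) show ?thesis by simp
    next
      case False
      then have d1: "deg G u = 1" "deg G v = 1" using deg uv by auto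
      let ?L = "\<lambda>X. {w\<in>X. deg G w \<le> 1}"
      have "{w\<in>X. deg (e # G) w \<le> 1} \<subseteq> (?L A - {u}) \<union> (?L B - {v})"
        using \<open>X = A \<union> B\<close> uv d1 by auto
      then have "card {w\<in>X. deg (e # G) w \<le> 1} \<le> card ((?L A - {u}) \<union> (?L B - {v}))"
        using fin A B by (intro card_mono) auto
      also have "\<dots> \<le> card (?L A - {u}) + card (?L B - {v})" by (rule card_Un_le)
      also have "\<dots> \<le> 1 + 1"
        using two[OF A(1)] two[OF B(1)] A B d1 fin by (intro add_mono) (auto simp: card_Diff_singleton)
      finally show ?thesis by simp
    qed
  qed
  ultimately show ?thesis
    using partition_on_merge[OF P S] uv by (auto simp: blocks_inv_def)
qed

lemma blocks_inv_mono:
  assumes "blocks_inv n G P"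
  shows "blocks_inv n (e # G) P"
proof -
  have "card {v\<in>A. deg (e # G) v \<le> 1} \<le> card {v\<in>A. deg G v \<le> 1}" if "A \<in> P" for A
  proof (rule card_mono)
    have "A \<subseteq> {..<n}" using assms that partition_onD1 by (auto simp: blocks_inv_def)
    then show "finite {v\<in>A. deg G v \<le> 1}" by (auto intro!: finite_subset[of _ "{..<n}"])
  qed auto
  then have "card {v\<in>A. deg (e # G) v \<le> 1} \<le> 2" if "A \<in> P" for A
    using assms that order.trans unfolding blocks_inv_def by blast
  with assms show ?thesis by (auto simp: blocks_inv_def)
qed

lemma blocks_inv_blocks: "valid_graph n G \<Longrightarrow> blocks_inv n G (blocks n \<gamma> G)"
proof (induction G)
  case Nil
  have "card {w. w = v \<and> deg [] w \<le> 1} \<le> 2" for v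
    using card_mono[of "{v}" "{w. w = v \<and> deg [] w \<le> 1}"] by auto
  then show ?case using partition_on_singletons by (auto simp: blocks_inv_def)
next
  case (Cons e G)
  then have "blocks_inv n G (blocks n \<gamma> G)" by simp
  then show ?case
    using blocks_inv_merge[of n G "blocks n \<gamma> G" e] blocks_inv_mono[of n G "blocks n \<gamma> G" e] Cons.prems
    by (auto simp: good_edge_def deg_class_def subset_iff)
qed

lemma partition_on_blocks: "valid_graph n G \<Longrightarrow> partition_on {..<n} (blocks n \<gamma> G)"
  using blocks_inv_blocks by (auto simp: blocks_inv_def)

subsection \<open>Components of the whole graph\<close>

lemma edge_in_block_or_bad:
  assumes "e \<in> set G" "e \<notin> set (bad_edges n \<gamma> G)" "valid_graph n G"
  shows "\<exists>A\<in>blocks n \<gamma> G. e \<subseteq> A"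
  using assms
proof (induction G)
  case (Cons f G)
  have part: "partition_on {..<n} (blocks n \<gamma> G)"
    using Cons.prems partition_on_blocks by simp
  show ?case
  proof (cases "good_edge n \<gamma> G f")
    case True
    show ?thesis
    proof (cases "e = f")
      case e: True
      have "f \<subseteq> \<Union>(blocks n \<gamma> G)"
        using partition_onD1[OF part] Cons.prems by simp
      then have "f \<subseteq> \<Union>{A \<in> blocks n \<gamma> G. A \<inter> f \<noteq> {}}" by blast
      then show ?thesis using True e by (auto simp: merge_blocks_def)
    next
      case False
      then obtain A where "A \<in> blocks n \<gamma> G" "e \<subseteq> A" using Cons True by auto
      then show ?thesis using True by (cases "A \<inter> f = {}") (auto simp: merge_blocks_def)
    qed
  next
    case False
    then show ?thesis using Cons by auto
  qed
qed simp

text \<open>The set \<open>X\<close> contains \<open>v\<close> and is closed under adjacency: an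
  edge that is not bad stays inside one block, and an endpoint of a bad edge lies in a block of
  \<open>X\<close> anyway.\<close>

lemma component_subset:
  fixes \<gamma> :: real
  assumes G: "valid_graph n G" and v: "v < n"
  defines "X \<equiv> \<Union>{A\<in>blocks n \<gamma> G. A \<inter> insert v (\<Union>(set (bad_edges n \<gamma> G))) \<noteq> {}}"
  shows "component n G v \<subseteq> X"
proof -
  have part: "partition_on {..<n} (blocks n \<gamma> G)" by (rule partition_on_blocks[OF G])
  have "v \<in> X" using v partition_onD1[OF part] by (auto simp: X_def)
  have step: "a \<in> X" if ab: "{a, b} \<in> set G" "b \<in> X" for a b
  proof (cases "{a, b} \<in> set (bad_edges n \<gamma> G)")
    case True
    have "a < n" using ab G by (auto simp: valid_graph_def)
    then obtain A where "A \<in> blocks n \<gamma> G" "a \<in> A" using partition_onD1[OF part] by blast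
    moreover have "a \<in> \<Union>(set (bad_edges n \<gamma> G))" using True by auto
    ultimately show ?thesis by (auto simp: X_def)
  next
    case False
    then obtain A where A: "A \<in> blocks n \<gamma> G" "a \<in> A" "b \<in> A"
      using edge_in_block_or_bad[OF ab(1) False G] by auto
    from ab(2) obtain B where B: "B \<in> blocks n \<gamma> G" "b \<in> B"
      "B \<inter> insert v (\<Union>(set (bad_edges n \<gamma> G))) \<noteq> {}" by (auto simp: X_def)
    then have "A = B" using A partition_onD2[OF part] by (auto simp: disjoint_def)
    then show ?thesis using A B by (auto simp: X_def)
  qed
  show ?thesis
  proof
    fix u assume "u \<in> component n G v"
    then have "(u, v) \<in> {(a, b). {a, b} \<in> set G}\<^sup>*"
      by (simp add: component_def connected_in_def)
    then show "u \<in> X"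
      using \<open>v \<in> X\<close> step by (induction rule: converse_rtrancl_induct) auto
  qed
qed

lemma card_Union_bad_edges:
  "valid_graph n G \<Longrightarrow> card (\<Union>(set (bad_edges n \<gamma> G))) \<le> 2 * length (bad_edges n \<gamma> G)"
proof (induction G)
  case (Cons e G)
  then show ?case
    using card_Un_le[of e "\<Union>(set (bad_edges n \<gamma> G))"] by auto
qed simp

text \<open>A component is covered by the blocks of \<open>v\<close> and of the endpoints of bad
  edges, one block of size at most \<open>L\<close> for each such vertex.\<close>

lemma largest_component_le:
  assumes G: "valid_graph n G" and L: "\<And>A. A \<in> blocks n \<gamma> G \<Longrightarrow> card A \<le> L"
  shows "largest_component n G \<le> (2 * length (bad_edges n \<gamma> G) + 1) * L"
proof -
  have part: "partition_on {..<n} (blocks n \<gamma> G)" by (rule partition_on_blocks[OF G])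
  have "card (component n G v) \<le> (2 * length (bad_edges n \<gamma> G) + 1) * L" if v: "v < n" for v
  proof -
    let ?D = "\<Union>(set (bad_edges n \<gamma> G))"
    have "set (bad_edges n \<gamma> G) \<subseteq> set G" by (induction G) auto
    then have D: "insert v ?D \<subseteq> {..<n}" using G v by (auto simp: valid_graph_def)
    then have fin: "finite (insert v ?D)" by (rule finite_subset) simp
    have one: "card (\<Union>{A\<in>blocks n \<gamma> G. w \<in> A}) \<le> L" if "w \<in> insert v ?D" for w
    proof -
      have "w \<in> {..<n}" using that D by blast
      then obtain A where "A \<in> blocks n \<gamma> G" "w \<in> A" "{X\<in>blocks n \<gamma> G. w \<in> X} = {A}"
        by (rule partition_on_unique[OF part])
      then show ?thesis using L by simp
    qed
    have "component n G v \<subseteq> (\<Union>w\<in>insert v ?D. \<Union>{A\<in>blocks n \<gamma> G. w \<in> A})"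
      using component_subset[OF G v, of \<gamma>] by blast
    moreover have "(\<Union>w\<in>insert v ?D. \<Union>{A\<in>blocks n \<gamma> G. w \<in> A}) \<subseteq> {..<n}"
      using partition_onD1[OF part] by auto
    ultimately have "card (component n G v) \<le> card (\<Union>w\<in>insert v ?D. \<Union>{A\<in>blocks n \<gamma> G. w \<in> A})"
      by (meson card_mono finite_lessThan finite_subset)
    also have "\<dots> \<le> (\<Sum>w\<in>insert v ?D. card (\<Union>{A\<in>blocks n \<gamma> G. w \<in> A}))"
      by (rule card_UN_le[OF fin])
    also have "\<dots> \<le> (\<Sum>w\<in>insert v ?D. L)" by (intro sum_mono one)
    also have "\<dots> = card (insert v ?D) * L" by simp
    also have "\<dots> \<le> (2 * length (bad_edges n \<gamma> G) + 1) * L"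
      using card_insert_le_m1[of "2 * length (bad_edges n \<gamma> G) + 1" ?D v] card_Union_bad_edges[OF G, of \<gamma>]
      by (intro mult_right_mono) auto
    finally show ?thesis .
  qed
  then show ?thesis by (simp add: largest_component_def)
qed

subsection \<open>The weight of a partition\<close>

definition wt :: "real \<Rightarrow> 'a set \<Rightarrow> real" where
  "wt \<delta> A = (1 + \<delta>) ^ card A - 1"

definition weight :: "real \<Rightarrow> 'a set set \<Rightarrow> real" where
  "weight \<delta> P = (\<Sum>A\<in>P. wt \<delta> A)"

text \<open>In a partition the sum has one term, the weight of the block of \<open>v\<close>.
  Writing it as a sum avoids selecting that block and permits exchanging sums.\<close>

definition point_weight :: "real \<Rightarrow> 'a set set \<Rightarrow> 'a \<Rightarrow> real" where
  "point_weight \<delta> P v = (\<Sum>A\<in>{A\<in>P. v \<in> A}. wt \<delta> A)"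

lemma wt_nonneg: "0 \<le> \<delta> \<Longrightarrow> 0 \<le> wt \<delta> A"
  by (simp add: wt_def)

lemma point_weight_nonneg: "0 \<le> \<delta> \<Longrightarrow> 0 \<le> point_weight \<delta> P v"
  by (simp add: point_weight_def sum_nonneg wt_nonneg)

text \<open>Subtracting \<open>1\<close> in \<^const>\<open>wt\<close> makes the increment of the weight a pure product:
  \<open>wt (A \<union> B) - wt A - wt B = wt A * wt B\<close> for disjoint \<open>A\<close>, \<open>B\<close>.\<close>

lemma weight_merge_le:
  assumes \<delta>: "0 \<le> \<delta>" and S: "finite S" and P: "partition_on S P" and uv: "u \<in> S" "v \<in> S"
  shows "weight \<delta> (merge_blocks P {u, v}) \<le> weight \<delta> P + point_weight \<delta> P u * point_weight \<delta> P v"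
proof -
  obtain A B where A: "A \<in> P" "u \<in> A" "{X\<in>P. u \<in> X} = {A}"
    and B: "B \<in> P" "v \<in> B" "{X\<in>P. v \<in> X} = {B}"
    and m: "merge_blocks P {u, v} = insert (A \<union> B) (P - {A, B})"
    using merge_edge[OF P uv] .
  have pw: "point_weight \<delta> P u = wt \<delta> A" "point_weight \<delta> P v = wt \<delta> B"
    unfolding point_weight_def A(3) B(3) by auto
  have finP: "finite P" using finite_elements[OF S P] .
  show ?thesis
  proof (cases "A = B")
    case True
    then have "merge_blocks P {u, v} = P" using m A by auto
    then show ?thesis using pw wt_nonneg[OF \<delta>, of A] wt_nonneg[OF \<delta>, of B] by simp
  next
    case False
    then have dj: "A \<inter> B = {}"
      using A(1) B(1) partition_onD2[OF P] by (simp add: disjoint_def)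
    have "A \<subseteq> S" "B \<subseteq> S" using A(1) B(1) partition_onD1[OF P] by blast+
    then have fin: "finite A" "finite B" using S finite_subset by blast+
    \<comment> \<open>The bound holds whether or not \<open>A \<union> B\<close> is already among
      the other blocks, hence the case split.\<close>
    have "weight \<delta> (merge_blocks P {u, v}) \<le> wt \<delta> (A \<union> B) + (\<Sum>X\<in>P - {A, B}. wt \<delta> X)"
      unfolding weight_def m using finP wt_nonneg[OF \<delta>]
      by (cases "A \<union> B \<in> P - {A, B}") (auto simp: insert_absorb)
    also have "(\<Sum>X\<in>P - {A, B}. wt \<delta> X) = weight \<delta> P - (wt \<delta> A + wt \<delta> B)"
      unfolding weight_def using finP A B False by (simp add: sum_diff)
    also have "wt \<delta> (A \<union> B) = wt \<delta> A + wt \<delta> B + wt \<delta> A * wt \<delta> B"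
      using dj fin by (simp add: wt_def card_Un_disjoint power_add algebra_simps)
    finally show ?thesis using pw by simp
  qed
qed

text \<open>Bernoulli's inequality gives each block weight at least \<open>\<delta>\<close> times
  its size. This keeps reciprocals of the weight positive and at most
  \<open>1 / (\<delta> * card S)\<close> when \<open>\<delta>\<close> and \<open>card S\<close> are
  positive.\<close>

lemma weight_ge:
  fixes \<delta> :: real
  assumes \<delta>: "0 \<le> \<delta>" and S: "finite S" and P: "partition_on S P"
  shows "\<delta> * card S \<le> weight \<delta> P"
proof -
  have "card S = (\<Sum>A\<in>P. card A)"
    using P S unfolding partition_on_def
    by (auto intro!: card_Union_disjoint finite_subset[OF _ S] simp: disjoint_def pairwise_def disjnt_def)
  then have "\<delta> * card S = (\<Sum>A\<in>P. card A * \<delta>)"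
    by (simp add: sum_distrib_left mult.commute)
  also have "\<dots> \<le> weight \<delta> P"
    unfolding weight_def wt_def using Bernoulli_inequality[of \<delta>] \<delta>
    by (intro sum_mono) (simp add: algebra_simps)
  finally show ?thesis .
qed

text \<open>Double counting: a block contributes its weight once for each of its vertices in
  \<open>D\<close>.\<close>

lemma sum_point_weight_le:
  assumes \<delta>: "0 \<le> \<delta>" and P: "finite P" and D: "finite D" and m: "\<And>A. A \<in> P \<Longrightarrow> card (A \<inter> D) \<le> m"
  shows "(\<Sum>v\<in>D. point_weight \<delta> P v) \<le> m * weight \<delta> P"
proof -
  have "(\<Sum>v\<in>D. point_weight \<delta> P v) = (\<Sum>A\<in>P. \<Sum>v\<in>{v\<in>D. v \<in> A}. wt \<delta> A)"
    unfolding point_weight_def by (rule sum.swap_restrict[OF D P])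
  also have "\<dots> = (\<Sum>A\<in>P. card (A \<inter> D) * wt \<delta> A)"
    by (intro sum.cong) (auto simp: Int_def conj_commute)
  also have "\<dots> \<le> (\<Sum>A\<in>P. m * wt \<delta> A)"
    using m wt_nonneg[OF \<delta>] by (intro sum_mono mult_right_mono) auto
  finally show ?thesis by (simp add: weight_def sum_distrib_left)
qed

text \<open>Every unordered pair appears as an ordered pair in the expansion of the square, whose
  other terms are nonnegative.\<close>

lemma sum_pairs_le:
  fixes x :: "'a \<Rightarrow> real"
  assumes D: "finite D" and x: "\<And>v. v \<in> D \<Longrightarrow> 0 \<le> x v"
  shows "(\<Sum>e\<in>{e. e \<subseteq> D \<and> card e = 2}. \<Prod>v\<in>e. x v) \<le> (\<Sum>v\<in>D. x v)\<^sup>2"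
proof -
  let ?Q = "{(u, v). u \<in> D \<and> v \<in> D \<and> u \<noteq> v}"
  have fin: "finite ?Q" by (rule finite_subset[of _ "D \<times> D"]) (use D in auto)
  have "(\<Sum>e\<in>{e. e \<subseteq> D \<and> card e = 2}. \<Prod>v\<in>e. x v) \<le> (\<Sum>p\<in>?Q. x (fst p) * x (snd p))"
  proof (rule sum_le_included[where i = "\<lambda>(u, v). {u, v}"])
    show "\<forall>e\<in>{e. e \<subseteq> D \<and> card e = 2}.
        \<exists>p\<in>?Q. (case p of (u, v) \<Rightarrow> {u, v}) = e \<and> (\<Prod>v\<in>e. x v) \<le> x (fst p) * x (snd p)"
    proof
      fix e assume e: "e \<in> {e. e \<subseteq> D \<and> card e = 2}"
      then obtain u v where "e = {u, v}" "u \<noteq> v" by (auto simp: card_2_iff)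
      with e show "\<exists>p\<in>?Q. (case p of (u, v) \<Rightarrow> {u, v}) = e \<and> (\<Prod>v\<in>e. x v) \<le> x (fst p) * x (snd p)"
        by (intro bexI[of _ "(u, v)"]) auto
    qed
  qed (use D fin x finite_pairs in auto)
  also have "\<dots> \<le> (\<Sum>p\<in>D \<times> D. x (fst p) * x (snd p))"
    using D x by (intro sum_mono2) auto
  also have "\<dots> = (\<Sum>v\<in>D. x v)\<^sup>2"
    by (simp add: power2_eq_square sum_product sum.cartesian_product case_prod_unfold)
  finally show ?thesis .
qed

text \<open>One block weighs no more than all of them, so
  \<open>(1 + \<delta>) ^ card A \<le> 1 + w\<close>; take logarithms and use
  \<open>ln (1 + \<delta>) \<ge> \<delta> / 2\<close>.\<close>

lemma card_le_of_weight:
  assumes \<delta>: "0 < \<delta>" "\<delta> \<le> 1 / 2" and P: "finite P" and W: "weight \<delta> P \<le> w" and A: "A \<in> P"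
  shows "card A \<le> 2 * ln (1 + w) / \<delta>"
proof -
  have "wt \<delta> A \<le> weight \<delta> P"
    unfolding weight_def using P A wt_nonneg[of \<delta>] \<delta> by (intro member_le_sum) auto
  with W have "(1 + \<delta>) ^ card A \<le> 1 + w" by (simp add: wt_def)
  then have "ln ((1 + \<delta>) ^ card A) \<le> ln (1 + w)"
    using \<delta> by (intro ln_mono) auto
  then have *: "card A * ln (1 + \<delta>) \<le> ln (1 + w)" using \<delta> by (simp add: ln_realpow)
  have "\<delta> / 2 \<le> \<delta> - \<delta>\<^sup>2"
    using \<delta> mult_left_mono[of \<delta> "1 / 2" \<delta>] by (simp add: power2_eq_square)
  also have "\<dots> \<le> ln (1 + \<delta>)"
    using \<delta> by (intro ln_one_plus_pos_lower_bound) auto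
  finally have "card A * (\<delta> / 2) \<le> card A * ln (1 + \<delta>)" by (intro mult_left_mono) auto
  with * \<delta> show ?thesis by (simp add: field_simps)
qed

subsection \<open>Markov bounds along the process\<close>

lemma set_pmf_drv:
  assumes "2 \<le> k" "k \<le> n" "G \<in> set_pmf (drv n k t)"
  shows "valid_graph n G" "length G = t"
  using assms(3)
proof (induction t arbitrary: G)
  case (Suc t)
  {
    case 1
    then show ?case using Suc set_drv_edge_subset[OF assms(1,2)] by (auto simp: drv_step_eq)
  next
    case 2
    then show ?case using Suc by (auto simp: drv_step_eq)
  }
qed auto

text \<open>A bound on the conditional increment at every reachable graph adds up over the steps.
  Nonnegative integrals dispense with integrability conditions.\<close>

lemma nn_integral_drv_le:
  fixes f :: "mgraph \<Rightarrow> ennreal"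
  assumes k: "2 \<le> k" "k \<le> n"
    and step: "\<And>G. valid_graph n G \<Longrightarrow> length G < t \<Longrightarrow>
      (\<integral>\<^sup>+e. f (e # G) \<partial>drv_edge n k G) \<le> f G + c"
  shows "(\<integral>\<^sup>+G. f G \<partial>drv n k t) \<le> f [] + of_nat t * c"
  using step
proof (induction t)
  case (Suc t)
  have "(\<integral>\<^sup>+G. f G \<partial>drv n k (Suc t)) = (\<integral>\<^sup>+G. (\<integral>\<^sup>+e. f (e # G) \<partial>drv_edge n k G) \<partial>drv n k t)"
    by (simp add: drv_step_eq)
  also have "\<dots> \<le> (\<integral>\<^sup>+G. f G + c \<partial>drv n k t)"
    by (intro nn_integral_mono_AE) (auto simp: AE_measure_pmf_iff intro!: Suc.prems dest: set_pmf_drv[OF k])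
  also have "\<dots> = (\<integral>\<^sup>+G. f G \<partial>drv n k t) + c"
    by (simp add: nn_integral_add measure_pmf.emeasure_space_1)
  also have "\<dots> \<le> (f [] + of_nat t * c) + c"
    using Suc by (intro add_right_mono) auto
  finally show ?case by (simp add: algebra_simps)
qed simp

text \<open>Markov's inequality. Negative values of \<open>f\<close> become 0 under
  \<open>ennreal\<close>, which is harmless because \<open>c\<close> is positive.\<close>

lemma prob_ge_le:
  assumes int: "(\<integral>\<^sup>+x. ennreal (f x) \<partial>measure_pmf p) \<le> ennreal b" and b: "0 \<le> b" and c: "0 < c"
  shows "measure_pmf.prob p {x. c \<le> f x} \<le> b / c"
proof -
  have "ennreal (c * measure_pmf.prob p {x. c \<le> f x}) = (\<integral>\<^sup>+x. ennreal c * indicator {x. c \<le> f x} x \<partial>measure_pmf p)"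
    using c by (simp add: nn_integral_cmult measure_pmf.emeasure_eq_measure ennreal_mult)
  also have "\<dots> \<le> (\<integral>\<^sup>+x. ennreal (f x) \<partial>measure_pmf p)"
    using c by (intro nn_integral_mono) (auto simp: indicator_def intro: ennreal_leI)
  also have "\<dots> \<le> ennreal b" by (rule int)
  finally have "c * measure_pmf.prob p {x. c \<le> f x} \<le> b" using b by simp
  then show ?thesis using c by (simp add: field_simps)
qed

text \<open>Turns a pointwise bound on a one-step change into a bound by probabilities of single
  edges, which are the quantities that symmetry controls.\<close>

lemma nn_integral_le_singletons:
  fixes p :: "'a pmf"
  assumes a: "0 \<le> a" and c: "\<And>y. y \<in> F \<Longrightarrow> 0 \<le> c y" and F: "finite F"
    and g: "\<And>x. x \<in> set_pmf p \<Longrightarrow> g x \<le> a + (\<Sum>y\<in>F. c y * indicator {y} x)"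
  shows "(\<integral>\<^sup>+x. ennreal (g x) \<partial>p) \<le> ennreal (a + (\<Sum>y\<in>F. c y * pmf p y))"
proof -
  let ?h = "\<lambda>x. a + (\<Sum>y\<in>F. c y * indicator {y} x)"
  have i: "integrable p (\<lambda>x. c y * indicator {y} x)" for y
    by (rule measure_pmf.integrable_const_bound[where B = "\<bar>c y\<bar>"]) (auto simp: indicator_def)
  have "(\<integral>\<^sup>+x. ennreal (g x) \<partial>p) \<le> (\<integral>\<^sup>+x. ennreal (?h x) \<partial>p)"
    using g by (intro nn_integral_mono_AE) (auto simp: AE_measure_pmf_iff intro!: ennreal_leI)
  also have "\<dots> = ennreal (\<integral>x. ?h x \<partial>p)"
  proof (rule nn_integral_eq_integral)
    show "integrable p ?h" using i by simp
    show "AE x in p. 0 \<le> ?h x" using a c by (auto intro!: add_nonneg_nonneg sum_nonneg)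
  qed
  also have "(\<integral>x. ?h x \<partial>p) = a + (\<Sum>y\<in>F. c y * pmf p y)"
  proof -
    have "(\<integral>x. ?h x \<partial>p) = a + (\<integral>x. (\<Sum>y\<in>F. c y * indicator {y} x) \<partial>p)"
      using i by (subst Bochner_Integration.integral_add) (auto intro!: Bochner_Integration.integrable_sum)
    also have "(\<integral>x. (\<Sum>y\<in>F. c y * indicator {y} x) \<partial>p) = (\<Sum>y\<in>F. \<integral>x. c y * indicator {y} x \<partial>p)"
      using i by (intro Bochner_Integration.integral_sum) auto
    finally show ?thesis by (simp add: measure_pmf_single)
  qed
  finally show ?thesis .
qed

subsection \<open>Counting bad edges\<close>

lemma sum_deg: "valid_graph n G \<Longrightarrow> (\<Sum>v<n. deg G v) = 2 * length G"
proof (induction G)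
  case (Cons e G)
  have "(\<Sum>v<n. of_bool (v \<in> e)) = card ({..<n} \<inter> e)"
    by (simp add: of_bool_def sum.If_cases Int_def conj_commute)
  also have "{..<n} \<inter> e = e" using Cons.prems by auto
  finally show ?case using Cons by (simp add: sum.distrib)
qed simp

text \<open>Each vertex satisfies \<open>2 \<le> deg + 2 * [deg = 0] + [deg = 1]\<close>; sum over
  all vertices.\<close>

lemma card_low_degree:
  assumes "valid_graph n G"
  shows "2 * n \<le> 2 * length G + 2 * card (deg_class n G 0) + card (deg_class n G 1)"
proof -
  have c: "(\<Sum>v<n. of_bool (deg G v = i)) = card (deg_class n G i)" for i
    by (simp add: of_bool_def sum.If_cases deg_class_def Int_def)
  have "2 * n = (\<Sum>v<n. 2)" by simp
  also have "\<dots> \<le> (\<Sum>v<n. deg G v + 2 * of_bool (deg G v = 0) + of_bool (deg G v = 1))"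
    by (intro sum_mono) auto
  also have "\<dots> = 2 * length G + 2 * card (deg_class n G 0) + card (deg_class n G 1)"
    unfolding sum.distrib sum_distrib_left[symmetric] c sum_deg[OF assms] ..
  finally show ?thesis .
qed

text \<open>Under the second alternative the candidates may still be isolated vertices instead of
  vertices of degree 1, but both kinds of edge are good.\<close>

lemma good_edge_of_two_hits:
  fixes n k :: nat and \<gamma> :: real
  assumes V: "V \<in> ksubsets n k" and e: "e \<subseteq> drv_candidates G V"
    and hit: "2 \<le> card (V \<inter> deg_class n G 0) \<or>
      \<gamma> * n \<le> card (deg_class n G 1) \<and> 2 \<le> card (V \<inter> deg_class n G 1)"
  shows "good_edge n \<gamma> G e"
proof -
  have "{v\<in>V. deg G v = i} = V \<inter> deg_class n G i" for i
    using V by (auto simp: deg_class_def ksubsets_def)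
  with e hit show ?thesis
    unfolding good_edge_def drv_candidates_def Let_def by (auto split: if_splits)
qed

lemma prob_bad_edge_le_miss:
  fixes n k :: nat and \<gamma> :: real
  assumes k: "2 \<le> k" "k \<le> n"
    and D: "D = deg_class n G 0 \<or> D = deg_class n G 1 \<and> \<gamma> * n \<le> card (deg_class n G 1)"
  shows "measure_pmf.prob (drv_edge n k G) {e. \<not> good_edge n \<gamma> G e}
    \<le> measure_pmf.prob (pmf_of_set (ksubsets n k)) {V. card (V \<inter> D) \<le> 1}"
proof -
  let ?F = "\<lambda>V. pmf_of_set {e. e \<subseteq> drv_candidates G V \<and> card e = 2}"
  let ?B = "{e. \<not> good_edge n \<gamma> G e}"
  have "emeasure (?F V) ?B \<le> indicator {V. card (V \<inter> D) \<le> 1} V" if V: "V \<in> ksubsets n k" for V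
  proof (cases "card (V \<inter> D) \<le> 1")
    case True
    then show ?thesis by (simp add: measure_pmf.emeasure_le_1)
  next
    case False
    then have "set_pmf (?F V) \<inter> ?B = {}"
      using good_edge_of_two_hits[OF V, of _ G \<gamma>] D set_pmf_of_set[OF ksubset_pairs(2,1)[OF k(1) V]]
      by auto
    then have "emeasure (?F V) ?B = 0"
      by (simp add: measure_pmf.emeasure_eq_measure measure_pmf_zero_iff)
    then show ?thesis by simp
  qed
  then have "emeasure (drv_edge n k G) ?B
      \<le> (\<integral>\<^sup>+V. indicator {V. card (V \<inter> D) \<le> 1} V \<partial>pmf_of_set (ksubsets n k))"
    unfolding drv_edge_def emeasure_bind_pmf using ksubsets_nonempty[OF k(2)]
    by (intro nn_integral_mono_AE) (simp add: AE_measure_pmf_iff)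
  then show ?thesis by (simp add: measure_pmf.emeasure_eq_measure)
qed

text \<open>The degree count leaves \<open>4 * \<gamma> * n \<le> 2 * n0 + n1\<close> for the sizes
  \<open>n0\<close>, \<open>n1\<close> of the classes of degree 0 and 1, so one of them has at least
  \<open>\<gamma> * n\<close> vertices, and a bad edge requires a sample with at most one of
  these.\<close>

lemma prob_bad_edge_le:
  fixes n k :: nat and \<gamma> :: real
  assumes k: "2 \<le> k" "k \<le> n" and G: "valid_graph n G" and \<gamma>: "3 \<le> \<gamma> * n"
    and len: "real (length G) \<le> (1 - 2 * \<gamma>) * n"
  shows "measure_pmf.prob (drv_edge n k G) {e. \<not> good_edge n \<gamma> G e} \<le> 2 * exp (- \<gamma> * k / 3)"
proof -
  have n: "0 < n" using k by simp
  have "2 * real n \<le> 2 * length G + 2 * card (deg_class n G 0) + card (deg_class n G 1)"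
    using card_low_degree[OF G] by linarith
  then have "\<gamma> * n \<le> card (deg_class n G 0) \<or> \<gamma> * n \<le> card (deg_class n G 1)"
    using len \<gamma> by (auto simp: algebra_simps)
  then obtain D where D: "D = deg_class n G 0 \<or> D = deg_class n G 1 \<and> \<gamma> * n \<le> card (deg_class n G 1)"
    and cD: "\<gamma> * n \<le> card D"
    by blast
  have sub: "D \<subseteq> {..<n}" using D by (auto simp: deg_class_def)
  let ?m = "card D div 2"
  have "?m \<le> n" using card_mono[OF _ sub] by simp
  have "card D \<le> 2 * ?m + 1" by linarith
  then have "\<gamma> * n \<le> 2 * real ?m + 1" using cD by linarith
  \<comment> \<open>The hypothesis \<open>3 \<le> \<gamma> * n\<close> absorbs the rounding:
    \<open>(\<gamma> * n - 1) / 2 \<ge> \<gamma> * n / 3\<close>.\<close>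
  then have m: "\<gamma> / 3 \<le> ?m / n" using \<gamma> n by (simp add: field_simps)
  have "measure_pmf.prob (drv_edge n k G) {e. \<not> good_edge n \<gamma> G e} \<le> 2 * (1 - ?m / n) ^ k"
    using prob_bad_edge_le_miss[OF k D] prob_le_one_hit[OF k(2) n sub] by linarith
  also have "\<dots> \<le> 2 * exp (- (\<gamma> / 3)) ^ k"
  proof -
    have "1 - ?m / n \<le> exp (- (?m / n))" using exp_ge_add_one_self[of "- (?m / n)"] by simp
    also have "\<dots> \<le> exp (- (\<gamma> / 3))" using m by simp
    finally show ?thesis
      using \<open>?m \<le> n\<close> n by (intro mult_left_mono power_mono) auto
  qed
  also have "exp (- (\<gamma> / 3)) ^ k = exp (- \<gamma> * k / 3)"
    by (simp add: exp_of_nat_mult[symmetric] mult.commute)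
  finally show ?thesis .
qed

text \<open>The integrand bounds the number of blocks covering a component. It starts at 1 and grows
  by 2 exactly when a bad edge arrives.\<close>

lemma nn_integral_bad_edges:
  fixes n k t :: nat and \<gamma> :: real
  assumes k: "2 \<le> k" "k \<le> n" and \<gamma>: "3 \<le> \<gamma> * n" and t: "real t \<le> (1 - 2 * \<gamma>) * n"
  shows "(\<integral>\<^sup>+G. ennreal (1 + 2 * length (bad_edges n \<gamma> G)) \<partial>drv n k t)
    \<le> ennreal (1 + 4 * real t * exp (- \<gamma> * k / 3))"
proof -
  let ?q = "2 * exp (- \<gamma> * k / 3)"
  let ?f = "\<lambda>G. ennreal (1 + 2 * length (bad_edges n \<gamma> G))"
  have "(\<integral>\<^sup>+G. ?f G \<partial>drv n k t) \<le> ?f [] + of_nat t * ennreal (2 * ?q)"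
  proof (rule nn_integral_drv_le[OF k])
    fix G assume G: "valid_graph n G" "length G < t"
    let ?B = "{e. \<not> good_edge n \<gamma> G e}"
    have "(\<integral>\<^sup>+e. ?f (e # G) \<partial>drv_edge n k G) = (\<integral>\<^sup>+e. ?f G + 2 * indicator ?B e \<partial>drv_edge n k G)"
      by (intro nn_integral_cong) (auto simp: indicator_def algebra_simps simp flip: ennreal_plus ennreal_numeral)
    also have "\<dots> = ?f G + 2 * emeasure (drv_edge n k G) ?B"
      by (simp add: nn_integral_add nn_integral_cmult measure_pmf.emeasure_space_1)
    also have "emeasure (drv_edge n k G) ?B \<le> ennreal ?q"
      unfolding measure_pmf.emeasure_eq_measure
      using G t by (intro ennreal_leI prob_bad_edge_le[OF k G(1) \<gamma>]) simp
    finally show "(\<integral>\<^sup>+e. ?f (e # G) \<partial>drv_edge n k G) \<le> ?f G + ennreal (2 * ?q)"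
      by (simp add: ennreal_mult mult_left_mono)
  qed
  also have "\<dots> = ennreal (1 + 4 * real t * exp (- \<gamma> * k / 3))"
    by (simp add: ennreal_of_nat_eq_real_of_nat flip: ennreal_mult ennreal_plus ennreal_1)
  finally show ?thesis .
qed

subsection \<open>Drift of the reciprocal weight\<close>

text \<open>The function \<open>- 1 / s\<close> is concave for positive \<open>s\<close>, so it lies
  below its tangent at \<open>S\<close>, which has slope \<open>1 / S\<^sup>2\<close>; the change of
  the weight is at most the product of the point weights.\<close>

lemma inverse_weight_step:
  fixes n :: nat and \<gamma> \<delta> :: real
  assumes \<delta>: "0 < \<delta>" and n: "0 < n" and G: "valid_graph n G" and e: "e \<subseteq> {..<n}" "card e = 2"
  defines "S \<equiv> weight \<delta> (blocks n \<gamma> G)"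
  shows "- 1 / weight \<delta> (blocks n \<gamma> (e # G)) \<le> - 1 / S +
    (if good_edge n \<gamma> G e then (\<Prod>v\<in>e. point_weight \<delta> (blocks n \<gamma> G) v) / S\<^sup>2 else 0)"
proof (cases "good_edge n \<gamma> G e")
  case True
  let ?S = "weight \<delta> (blocks n \<gamma> (e # G))" and ?x = "\<Prod>v\<in>e. point_weight \<delta> (blocks n \<gamma> G) v"
  obtain u v where uv: "e = {u, v}" "u \<noteq> v" using e(2) by (auto simp: card_2_iff)
  have "?S \<le> S + ?x"
    using weight_merge_le[of \<delta> "{..<n}" "blocks n \<gamma> G" u v] \<delta> e uv True partition_on_blocks[OF G]
    by (simp add: S_def)
  moreover have "0 < \<delta> * n" using \<delta> n by simp
  moreover have "\<delta> * n \<le> S"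
    unfolding S_def using weight_ge[OF _ _ partition_on_blocks[OF G], of \<delta> \<gamma>] \<delta> by simp
  moreover have "\<delta> * n \<le> ?S"
    using weight_ge[OF _ _ partition_on_blocks, of \<delta> n "e # G" \<gamma>] \<delta> G e by simp
  ultimately have pos: "0 < S" "0 < ?S" and le: "?S - S \<le> ?x" by linarith+
  have "1 / S - 1 / ?S = (?S - S) / S\<^sup>2 - (?S - S)\<^sup>2 / (S\<^sup>2 * ?S)"
    using pos by (simp add: field_simps power2_eq_square)
  also have "\<dots> \<le> (?S - S) / S\<^sup>2" using pos by simp
  also have "\<dots> \<le> ?x / S\<^sup>2" using le pos by (intro divide_right_mono) auto
  finally show ?thesis using True by simp
qed (simp add: S_def)

text \<open>The factor \<open>S\<^sup>2\<close> in the expected growth cancels against the slope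
  \<open>1 / S\<^sup>2\<close>, leaving a drift independent of \<open>S\<close>. The shift
  \<open>1 / (\<delta> * n)\<close> makes the quantity nonnegative, so \<open>ennreal\<close> loses
  nothing.\<close>

lemma nn_integral_inverse_weight_step:
  fixes n k :: nat and \<gamma> \<delta> :: real
  assumes k: "2 \<le> k" "k \<le> n" and \<gamma>: "3 \<le> \<gamma> * n" "0 < \<gamma>" and \<delta>: "0 < \<delta>" and G: "valid_graph n G"
  shows "(\<integral>\<^sup>+e. ennreal (1 / (\<delta> * n) - 1 / weight \<delta> (blocks n \<gamma> (e # G))) \<partial>drv_edge n k G)
    \<le> ennreal (1 / (\<delta> * n) - 1 / weight \<delta> (blocks n \<gamma> G)) + ennreal ((1 + 12 / \<gamma>\<^sup>2) / (real n)\<^sup>2)"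
proof -
  let ?P = "blocks n \<gamma> G"
  let ?D = "deg_class n G 1"
  let ?E = "{e. e \<subseteq> ?D \<and> card e = 2}"
  define S where "S = weight \<delta> ?P"
  define x where "x = point_weight \<delta> ?P"
  \<comment> \<open>The contribution of a pair of degree 1; below the threshold such a pair is bad
    and does not change the blocks.\<close>
  define c where "c e = (if \<gamma> * n \<le> card ?D then (\<Prod>v\<in>e. x v) / S\<^sup>2 else 0)" for e
  have n: "0 < n" using k by simp
  have part: "partition_on {..<n} ?P" and inv: "blocks_inv n G ?P"
    using G partition_on_blocks blocks_inv_blocks by auto
  have S: "\<delta> * n \<le> S" unfolding S_def using weight_ge[OF _ _ part, of \<delta>] \<delta> by simp
  moreover have "0 < \<delta> * n" using \<delta> n by simp
  ultimately have Spos: "0 < S" by linarith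
  have x0: "0 \<le> x v" for v unfolding x_def using \<delta> by (intro point_weight_nonneg) auto
  have c0: "0 \<le> c e" for e unfolding c_def using x0 by (auto intro!: divide_nonneg_nonneg prod_nonneg)
  have finE: "finite ?E" by (rule finite_pairs) simp
  have pt: "1 / (\<delta> * n) - 1 / weight \<delta> (blocks n \<gamma> (e # G)) \<le>
      (1 / (\<delta> * n) - 1 / S + 1 / (real n)\<^sup>2) + (\<Sum>f\<in>?E. c f * indicator {f} e)"
    if "e \<in> set_pmf (drv_edge n k G)" for e
  proof -
    have e: "e \<subseteq> {..<n}" "card e = 2" using set_drv_edge_subset[OF k that] .
    have sum: "(\<Sum>f\<in>?E. c f * indicator {f} e) = (if e \<in> ?E then c e else 0)"
      using finE by (simp add: indicator_def if_distrib sum.delta' cong: if_cong)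
    \<comment> \<open>Isolated endpoints are singleton blocks, so the product is
      \<open>\<delta>\<^sup>2\<close>, while \<open>S \<ge> \<delta> * n\<close>.\<close>
    have "(\<Prod>v\<in>e. x v) / S\<^sup>2 \<le> 1 / (real n)\<^sup>2" if e0: "e \<subseteq> deg_class n G 0"
    proof -
      have "x v = \<delta>" if "v \<in> e" for v
      proof -
        have v: "{v} \<in> {X\<in>?P. v \<in> X}" "v \<in> {..<n}"
          using inv e0 that by (auto simp: blocks_inv_def deg_class_def)
        from part v(2) obtain A where A: "{X\<in>?P. v \<in> X} = {A}"
          by (rule partition_on_unique)
        with v(1) have "A = {v}" by simp
        with A show ?thesis by (simp add: x_def point_weight_def wt_def)
      qed
      then have "(\<Prod>v\<in>e. x v) = \<delta>\<^sup>2" using e(2) by simp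
      moreover have "(\<delta> * n)\<^sup>2 \<le> S\<^sup>2" using S \<delta> by (intro power_mono) auto
      ultimately show ?thesis using Spos n \<delta> by (simp add: field_simps power_mult_distrib)
    qed
    moreover have "0 \<le> 1 / (real n)\<^sup>2" by simp
    ultimately have "(if good_edge n \<gamma> G e then (\<Prod>v\<in>e. x v) / S\<^sup>2 else 0)
        \<le> 1 / (real n)\<^sup>2 + (if e \<in> ?E then c e else 0)"
      using c0[of e] e(2) by (auto simp: good_edge_def c_def)
    then show ?thesis
      using inverse_weight_step[OF \<delta> n G e, of \<gamma>] unfolding sum S_def x_def by simp
  qed
  have nonneg: "0 \<le> 1 / (\<delta> * n) - 1 / S"
    using S \<open>0 < \<delta> * n\<close> by (simp add: frac_le)
  have drift: "(\<Sum>f\<in>?E. c f * pmf (drv_edge n k G) f) \<le> 12 / (\<gamma>\<^sup>2 * n\<^sup>2)"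
  proof (cases "\<gamma> * n \<le> card ?D")
    case False
    then show ?thesis by (simp add: c_def)
  next
    case True
    have "pmf (drv_edge n k G) f \<le> 3 / (\<gamma> * n)\<^sup>2" if "f \<in> ?E" for f
    proof -
      have "1 \<le> card ?D" using True \<gamma> by (cases "card ?D") auto
      moreover have "2 * (card ?D choose 2) = card ?D * (card ?D - 1)"
        using binomial_absorption[of 1 "card ?D"] by (simp add: numeral_2_eq_2)
      then have "real (2 * (card ?D choose 2)) = real (card ?D * (card ?D - 1))" by (rule arg_cong)
      ultimately have "2 * real (card ?D choose 2) = card ?D * (real (card ?D) - 1)"
        by (simp add: of_nat_diff)
      \<comment> \<open>Here \<open>\<gamma> * n \<ge> 3\<close> gives
        \<open>\<gamma> * n - 1 \<ge> 2 / 3 * (\<gamma> * n)\<close>.\<close>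
      also have "\<dots> \<ge> (\<gamma> * n) * (2 / 3 * (\<gamma> * n))"
        using True \<gamma> by (intro mult_mono) auto
      finally have ch: "(\<gamma> * n)\<^sup>2 / 3 \<le> real (card ?D choose 2)"
        by (simp add: power2_eq_square mult_ac)
      have "pmf (drv_edge n k G) f * ((\<gamma> * n)\<^sup>2 / 3) \<le> pmf (drv_edge n k G) f * real (card ?D choose 2)"
        by (intro mult_left_mono ch) simp
      also have "\<dots> \<le> 1" using pmf_drv_edge_le[OF k, of f G 1] that by auto
      finally show ?thesis using \<gamma> n by (simp add: field_simps)
    qed
    then have "(\<Sum>f\<in>?E. c f * pmf (drv_edge n k G) f) \<le> (\<Sum>f\<in>?E. c f * (3 / (\<gamma> * n)\<^sup>2))"
      using c0 by (intro sum_mono mult_left_mono) auto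
    also have "\<dots> = (\<Sum>f\<in>?E. c f) * (3 / (\<gamma> * n)\<^sup>2)"
      by (rule sum_distrib_right[symmetric])
    also have "(\<Sum>f\<in>?E. c f) = (\<Sum>f\<in>?E. \<Prod>v\<in>f. x v) / S\<^sup>2"
      using True by (simp add: c_def sum_divide_distrib)
    also have "\<dots> * (3 / (\<gamma> * n)\<^sup>2) \<le> 4 * (3 / (\<gamma> * n)\<^sup>2)"
    proof (rule mult_right_mono)
      \<comment> \<open>Each block is counted at most twice, so the point weights over
        \<open>?D\<close> sum to at most \<open>2 * S\<close>; squaring gives the 4.\<close>
      have "card (A \<inter> ?D) \<le> 2" if "A \<in> ?P" for A
      proof -
        have "A \<subseteq> {..<n}" using that partition_onD1[OF part] by blast
        then have "card (A \<inter> ?D) \<le> card {v\<in>A. deg G v \<le> 1}"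
          by (intro card_mono) (auto simp: deg_class_def intro: finite_subset)
        then show ?thesis using inv that by (fastforce simp: blocks_inv_def)
      qed
      then have "(\<Sum>v\<in>?D. x v) \<le> 2 * S"
        unfolding x_def S_def using sum_point_weight_le[of \<delta> ?P ?D 2] \<delta> finite_elements[OF _ part] by simp
      then have "(\<Sum>v\<in>?D. x v)\<^sup>2 \<le> (2 * S)\<^sup>2" using x0 by (intro power_mono sum_nonneg) auto
      then have "(\<Sum>f\<in>?E. \<Prod>v\<in>f. x v) \<le> (2 * S)\<^sup>2"
        using sum_pairs_le[of ?D x] x0 by auto
      then show "(\<Sum>f\<in>?E. \<Prod>v\<in>f. x v) / S\<^sup>2 \<le> 4"
        using Spos by (simp add: field_simps power_mult_distrib)
    qed simp
    finally show ?thesis by (simp add: power_mult_distrib)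
  qed
  have "(\<integral>\<^sup>+e. ennreal (1 / (\<delta> * n) - 1 / weight \<delta> (blocks n \<gamma> (e # G))) \<partial>drv_edge n k G)
      \<le> ennreal ((1 / (\<delta> * n) - 1 / S + 1 / (real n)\<^sup>2) + (\<Sum>f\<in>?E. c f * pmf (drv_edge n k G) f))"
    using nonneg c0 finE pt by (intro nn_integral_le_singletons) auto
  also have "\<dots> \<le> ennreal ((1 / (\<delta> * n) - 1 / S) + (1 + 12 / \<gamma>\<^sup>2) / (real n)\<^sup>2)"
    using drift by (intro ennreal_leI) (simp add: add_divide_distrib)
  also have "\<dots> = ennreal (1 / (\<delta> * n) - 1 / S) + ennreal ((1 + 12 / \<gamma>\<^sup>2) / (real n)\<^sup>2)"
    using nonneg by (intro ennreal_plus) auto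
  finally show ?thesis by (simp add: S_def)
qed

text \<open>The shifted reciprocal \<open>?f\<close> starts at 0 and has mean at most
  \<open>?K / n\<close> after \<open>t \<le> n\<close> steps, whereas weight at least
  \<open>n\<close> forces it up to \<open>1 / (\<delta> * n) - 1 / n\<close>. Markov's inequality
  leaves a factor of order \<open>\<delta>\<close>.\<close>

lemma prob_weight_ge:
  fixes n k t :: nat and \<gamma> \<delta> :: real
  assumes k: "2 \<le> k" "k \<le> n" and \<gamma>: "3 \<le> \<gamma> * n" "0 < \<gamma>" and \<delta>: "0 < \<delta>" "\<delta> < 1" and t: "t \<le> n"
  shows "measure_pmf.prob (drv n k t) {G. real n \<le> weight \<delta> (blocks n \<gamma> G)}
    \<le> (1 + 12 / \<gamma>\<^sup>2) * \<delta> / (1 - \<delta>)"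
proof -
  let ?K = "1 + 12 / \<gamma>\<^sup>2"
  let ?f = "\<lambda>G. 1 / (\<delta> * n) - 1 / weight \<delta> (blocks n \<gamma> G)"
  have n: "0 < n" using k by simp
  have K: "0 \<le> ?K" by simp
  have nil: "weight \<delta> (blocks n \<gamma> []) = \<delta> * n"
    by (simp add: weight_def sum.reindex wt_def)
  have "(\<integral>\<^sup>+G. ennreal (?f G) \<partial>drv n k t) \<le> ennreal (?f []) + of_nat t * ennreal (?K / (real n)\<^sup>2)"
    by (rule nn_integral_drv_le[OF k]) (rule nn_integral_inverse_weight_step[OF k \<gamma> \<delta>(1)])
  also have "\<dots> = ennreal (real t * (?K / (real n)\<^sup>2))"
    using nil K by (subst ennreal_mult) (auto simp: ennreal_of_nat_eq_real_of_nat)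
  also have "\<dots> \<le> ennreal (real n * (?K / (real n)\<^sup>2))"
    using t K by (intro ennreal_leI mult_right_mono) auto
  also have "real n * (?K / (real n)\<^sup>2) = ?K / n" using n by (simp add: power2_eq_square)
  finally have E: "(\<integral>\<^sup>+G. ennreal (?f G) \<partial>drv n k t) \<le> ennreal (?K / n)" .
  have "measure_pmf.prob (drv n k t) {G. real n \<le> weight \<delta> (blocks n \<gamma> G)}
      \<le> measure_pmf.prob (drv n k t) {G. (1 - \<delta>) / (\<delta> * n) \<le> ?f G}"
  proof (rule measure_pmf.finite_measure_mono)
    have "(1 - \<delta>) / (\<delta> * n) = 1 / (\<delta> * n) - 1 / n"
      using \<delta> n by (simp add: field_simps)
    then show "{G. real n \<le> weight \<delta> (blocks n \<gamma> G)} \<subseteq> {G. (1 - \<delta>) / (\<delta> * n) \<le> ?f G}"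
      using n by (auto intro!: frac_le)
  qed simp
  also have "\<dots> \<le> (?K / n) / ((1 - \<delta>) / (\<delta> * n))"
    using E K \<delta> n by (intro prob_ge_le) auto
  also have "\<dots> = ?K * \<delta> / (1 - \<delta>)" using \<delta> n by (simp add: field_simps)
  finally show ?thesis .
qed

subsection \<open>Conclusion\<close>

text \<open>Union bound: outside \<open>?A\<close> every block has size at most \<open>?L\<close>,
  and outside \<open>?B\<close> fewer than \<open>\<epsilon> * n / ?L\<close> blocks cover a
  component.\<close>

lemma prob_largest_component_gt:
  fixes n k t :: nat and \<gamma> \<delta> \<epsilon> :: real
  assumes k: "2 \<le> k" "k \<le> n" and \<gamma>: "3 \<le> \<gamma> * n" "0 < \<gamma>" and \<delta>: "0 < \<delta>" "\<delta> \<le> 1 / 2"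
    and t: "real t \<le> (1 - 2 * \<gamma>) * n" and \<epsilon>: "0 < \<epsilon>"
  shows "measure_pmf.prob (drv n k t) {G. real (largest_component n G) > \<epsilon> * n}
    \<le> (1 + 12 / \<gamma>\<^sup>2) * \<delta> / (1 - \<delta>) +
       (1 + 4 * real n * exp (- \<gamma> * k / 3)) * (2 * ln (1 + real n) / \<delta>) / (\<epsilon> * n)"
proof -
  let ?M = "drv n k t" and ?L = "2 * ln (1 + real n) / \<delta>"
  let ?A = "{G. real n \<le> weight \<delta> (blocks n \<gamma> G)}"
  let ?B = "{G. \<epsilon> * n / ?L \<le> 1 + 2 * length (bad_edges n \<gamma> G)}"
  have n: "0 < n" using k by simp
  then have L: "0 < ?L" using \<delta> by simp
  have pos: "0 < \<epsilon> * n / ?L" using \<epsilon> n by (intro divide_pos_pos mult_pos_pos L) auto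
  have tn: "real t \<le> n" using t \<gamma> by (simp add: algebra_simps)
  have "measure_pmf.prob ?M {G. real (largest_component n G) > \<epsilon> * n} \<le> measure_pmf.prob ?M (?A \<union> ?B)"
  proof (rule measure_pmf.finite_measure_mono_AE)
    have "G \<in> ?A \<union> ?B" if "G \<in> set_pmf ?M" "\<epsilon> * n < largest_component n G" for G
    proof (rule ccontr)
      assume "G \<notin> ?A \<union> ?B"
      then have W: "weight \<delta> (blocks n \<gamma> G) \<le> n"
        and b: "1 + 2 * length (bad_edges n \<gamma> G) < \<epsilon> * n / ?L" by auto
      have G: "valid_graph n G" using set_pmf_drv[OF k that(1)] by simp
      have "card A \<le> nat \<lfloor>?L\<rfloor>" if "A \<in> blocks n \<gamma> G" for A
        using card_le_of_weight[OF \<delta> finite_elements[OF _ partition_on_blocks[OF G]] W that]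
        by (simp add: le_nat_floor)
      then have "largest_component n G \<le> (2 * length (bad_edges n \<gamma> G) + 1) * nat \<lfloor>?L\<rfloor>"
        by (rule largest_component_le[OF G])
      then have "real (largest_component n G) \<le> real (2 * length (bad_edges n \<gamma> G) + 1) * real (nat \<lfloor>?L\<rfloor>)"
        by (metis of_nat_le_iff of_nat_mult)
      also have "\<dots> \<le> (1 + 2 * length (bad_edges n \<gamma> G)) * ?L"
        using L by (intro mult_mono) auto
      also have "\<dots> < \<epsilon> * n" using b L by (simp only: pos_less_divide_eq)
      finally show False using that by simp
    qed
    then show "AE G in ?M. G \<in> {G. real (largest_component n G) > \<epsilon> * n} \<longrightarrow> G \<in> ?A \<union> ?B"
      by (auto simp: AE_measure_pmf_iff)
  qed simp
  also have "\<dots> \<le> measure_pmf.prob ?M ?A + measure_pmf.prob ?M ?B"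
    by (intro measure_Un_le) auto
  also have "measure_pmf.prob ?M ?A \<le> (1 + 12 / \<gamma>\<^sup>2) * \<delta> / (1 - \<delta>)"
    using prob_weight_ge[OF k \<gamma>, of \<delta> t] \<delta> tn by simp
  also have "measure_pmf.prob ?M ?B \<le> (1 + 4 * real t * exp (- \<gamma> * k / 3)) / (\<epsilon> * n / ?L)"
    by (intro prob_ge_le[OF nn_integral_bad_edges[OF k \<gamma>(1) t] _ pos]) simp
  also have "\<dots> \<le> (1 + 4 * real n * exp (- \<gamma> * k / 3)) / (\<epsilon> * n / ?L)"
    using tn pos by (intro divide_right_mono add_left_mono mult_right_mono) auto
  also have "\<dots> = (1 + 4 * real n * exp (- \<gamma> * k / 3)) * ?L / (\<epsilon> * n)"
    by (rule divide_divide_eq_right)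
  finally show ?thesis by simp
qed

theorem theorem1:
  fixes k :: "nat \<Rightarrow> nat" and d :: real
  assumes k_range: "\<And>n. n \<ge> 2 \<Longrightarrow> 2 \<le> k n \<and> k n \<le> n"
    and k_inf: "filterlim k at_top sequentially"
    and k_log: "(\<lambda>n. real (k n)) \<in> \<Omega>(\<lambda>n. ln (real n))"
    and d: "0 < d" "d < 1"
  shows "\<forall>\<epsilon>>0. ((\<lambda>n. measure_pmf.prob (drv n (k n) (nat \<lfloor>d * real n\<rfloor>))
                 {G. real (largest_component n G) > \<epsilon> * real n}) \<longlongrightarrow> 0) sequentially"
proof (intro allI impI)
  fix \<epsilon> :: real assume \<epsilon>: "0 < \<epsilon>"
  define \<gamma> where "\<gamma> = (1 - d) / 2"
  have \<gamma>: "0 < \<gamma>" "d = 1 - 2 * \<gamma>" using d by (auto simp: \<gamma>_def field_simps)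
  from k_log obtain C where C: "0 < C" and kC: "\<forall>\<^sub>F n in sequentially. norm (real (k n)) \<ge> C * norm (ln (real n))"
    by (auto elim: landau_omega.bigE)
  \<comment> \<open>With \<open>k n \<ge> C * ln n\<close>, the factor
    \<open>exp (- \<gamma> * k n / 3)\<close> is at most \<open>exp (- a * ln n)\<close>, that is,
    \<open>n powr -a\<close>.\<close>
  define a where "a = \<gamma> * C / 3"
  have a: "0 < a" using \<gamma> C by (simp add: a_def)
  \<comment> \<open>It tends to 0, which removes the first term of the bound, and so slowly that
    \<open>1 / \<delta> n\<close> costs only a logarithm against the gain
    \<open>n powr -a\<close>.\<close>
  define \<delta> :: "nat \<Rightarrow> real" where "\<delta> n = 1 / ln n" for n
  define K where "K = 1 + 12 / \<gamma>\<^sup>2"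
  have K: "0 < K" using \<gamma> by (auto simp: K_def intro!: add_pos_nonneg)
  define bound where "bound n = K * \<delta> n / (1 - \<delta> n) +
       (1 + 4 * real n * exp (- a * ln n)) * (2 * ln (1 + real n) / \<delta> n) / (\<epsilon> * n)" for n :: nat
  have bound0: "bound \<longlonglongrightarrow> 0"
  proof -
    have "(\<lambda>n::nat. K * (1 / ln n) / (1 - 1 / ln n)) \<longlonglongrightarrow> 0"
      using K by real_asymp
    moreover have "(\<lambda>n::nat. 2 * ln (1 + real n) * ln n / (\<epsilon> * n)) \<longlonglongrightarrow> 0"
      using \<epsilon> by real_asymp
    moreover have "(\<lambda>n::nat. 8 * exp (- a * ln n) * ln (1 + real n) * ln n / \<epsilon>) \<longlonglongrightarrow> 0"
      using a \<epsilon> by real_asymp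
    ultimately have "(\<lambda>n::nat. K * (1 / ln n) / (1 - 1 / ln n) + (2 * ln (1 + real n) * ln n / (\<epsilon> * n)
        + 8 * exp (- a * ln n) * ln (1 + real n) * ln n / \<epsilon>)) \<longlonglongrightarrow> 0"
      by (intro tendsto_add_zero)
    moreover have "\<forall>\<^sub>F n in sequentially. K * (1 / ln (real n)) / (1 - 1 / ln n) + (2 * ln (1 + real n) * ln n / (\<epsilon> * n)
        + 8 * exp (- a * ln n) * ln (1 + real n) * ln n / \<epsilon>) = bound n"
      using eventually_gt_at_top[of 0]
    proof eventually_elim
      case (elim n)
      then show ?case using \<epsilon> by (simp add: bound_def \<delta>_def field_simps)
    qed
    ultimately show ?thesis by (rule Lim_transform_eventually)
  qed
  have "\<forall>\<^sub>F n :: nat in sequentially. 3 \<le> \<gamma> * n"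
    using \<gamma>(1) by real_asymp
  \<comment> \<open>This ensures \<open>\<delta> n \<le> 1 / 2\<close>.\<close>
  moreover have "\<forall>\<^sub>F n :: nat in sequentially. 2 \<le> ln (real n)"
    by real_asymp
  ultimately have "\<forall>\<^sub>F n in sequentially. measure_pmf.prob (drv n (k n) (nat \<lfloor>d * real n\<rfloor>))
                 {G. real (largest_component n G) > \<epsilon> * real n} \<le> bound n"
    using kC eventually_ge_at_top[of 2]
  proof eventually_elim
    case (elim n)
    have k: "2 \<le> k n" "k n \<le> n" using k_range elim by auto
    have \<delta>: "0 < \<delta> n" "\<delta> n \<le> 1 / 2" using elim by (auto simp: \<delta>_def field_simps)
    have t: "real (nat \<lfloor>d * real n\<rfloor>) \<le> (1 - 2 * \<gamma>) * n"
      using d \<gamma>(2) by (simp add: of_nat_nat)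
    have "C * ln n \<le> k n" using elim by simp
    then have "\<gamma> / 3 * (C * ln n) \<le> \<gamma> / 3 * k n" using \<gamma> by (intro mult_left_mono) auto
    then have exp: "exp (- \<gamma> * k n / 3) \<le> exp (- a * ln n)" by (simp add: a_def)
    have "(1 + 4 * real n * exp (- \<gamma> * k n / 3)) * (2 * ln (1 + real n) / \<delta> n) / (\<epsilon> * n)
        \<le> (1 + 4 * real n * exp (- a * ln n)) * (2 * ln (1 + real n) / \<delta> n) / (\<epsilon> * n)"
      using exp \<delta> \<epsilon> elim
      by (intro divide_right_mono mult_right_mono add_left_mono mult_left_mono) auto
    then show ?case
      using prob_largest_component_gt[OF k _ \<gamma>(1) \<delta> t \<epsilon>] elim unfolding bound_def K_def by linarith
  qed
  then show "((\<lambda>n. measure_pmf.prob (drv n (k n) (nat \<lfloor>d * real n\<rfloor>))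
                 {G. real (largest_component n G) > \<epsilon> * real n}) \<longlongrightarrow> 0) sequentially"
    using tendsto_sandwich[of "\<lambda>_. 0" _ sequentially bound 0] bound0 by (auto simp: eventually_mono)
qed

end
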